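(* Let $(\mathfrak{g},[\cdot,\cdot])$ be a Leibniz algebra and $N:\mathfrak{g}\to\mathfrak{g}$ a Nijenhuis operator on it. Then the bilinear operations $$x\triangleright y=[x,Ny],\qquad x\triangleleft y=[Nx,y],\qquad x\diamond y=-N[x,y],\qquad x,y\in\mathfrak{g},$$ define an NS-Leibniz algebra structure on $\mathfrak{g}$.
   Context: All vector spaces are finite-dimensional over $\mathbb{C}$. A Leibniz algebra is a vector space $\mathfrak{g}$ with a bilinear bracket satisfying $[x,[y,z]]=[[x,y],z]+[y,[x,z]]$ for all $x,y,z\in\mathfrak{g}$. A Nijenhuis operator on $\mathfrak{g}$ is a linear map $N:\mathfrak{g}\to\mathfrak{g}$ with $[Nx,Ny]=N([Nx,y]+[x,Ny]-N[x,y])$ for all $x,y\in\mathfrak{g}$. An NS-Leibniz algebra is a vector space $A$ with three bilinear operations $\triangleright,\triangleleft,\diamond:A\otimes A\to A$ such that, with $x\ast y=x\triangleright y+x\triangleleft y+x\diamond y$, for all $x,y,z\in A$: (A1) $x\triangleright(y\ast z)=(x\triangleright y)\triangleright z+y\triangleleft(x\triangleright z)$; (A2) $x\triangleleft(y\triangleright z)=(x\triangleleft y)\triangleright z+y\triangleright(x\ast z)$; (A3) $x\triangleleft(y\triangleleft z)=(x\ast y)\triangleleft z+y\triangleleft(x\triangleleft z)$; (A4) $x\triangleleft(y\diamond z)+x\diamond(y\ast z)=(x\diamond y)\triangleright z+(x\ast y)\diamond z+y\triangleleft(x\diamond z)+y\diamond(x\ast z)$. *)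

theory Defs
  imports Complex_Main
begin

locale fd_complex_vector_space = vector_space scale
  for scale :: "complex \<Rightarrow> 'g::ab_group_add \<Rightarrow> 'g" +
  assumes finite_dim: "\<exists>Basis. finite_dimensional_vector_space scale Basis"

text \<open>The library's \<open>bilinear\<close> is restricted to real scalars.\<close>

definition bilinear_op ::
  "(complex \<Rightarrow> 'g::ab_group_add \<Rightarrow> 'g) \<Rightarrow> ('g \<Rightarrow> 'g \<Rightarrow> 'g) \<Rightarrow> bool" where
  "bilinear_op scale m \<longleftrightarrow>
     (\<forall>x. Vector_Spaces.linear scale scale (\<lambda>y. m x y)) \<and>
     (\<forall>y. Vector_Spaces.linear scale scale (\<lambda>x. m x y))"

text \<open>The convention is that of left Leibniz algebras: left multiplications are derivations.\<close>

locale leibniz_algebra = fd_complex_vector_space scale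
  for scale :: "complex \<Rightarrow> 'g::ab_group_add \<Rightarrow> 'g" +
  fixes br :: "'g \<Rightarrow> 'g \<Rightarrow> 'g"
  assumes bilinear_br: "bilinear_op scale br"
    and leibniz: "br x (br y z) = br (br x y) z + br y (br x z)"

definition nijenhuis_operator ::
  "(complex \<Rightarrow> 'g::ab_group_add \<Rightarrow> 'g) \<Rightarrow> ('g \<Rightarrow> 'g \<Rightarrow> 'g) \<Rightarrow> ('g \<Rightarrow> 'g) \<Rightarrow> bool" where
  "nijenhuis_operator scale br N \<longleftrightarrow>
     Vector_Spaces.linear scale scale N \<and>
     (\<forall>x y. br (N x) (N y) = N (br (N x) y + br x (N y) - N (br x y)))"

locale ns_leibniz_algebra = fd_complex_vector_space scale
  for scale :: "complex \<Rightarrow> 'g::ab_group_add \<Rightarrow> 'g" +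
  fixes rt :: "'g \<Rightarrow> 'g \<Rightarrow> 'g"  (infixl \<open>\<triangleright>\<close> 70)
    and lt :: "'g \<Rightarrow> 'g \<Rightarrow> 'g"  (infixl \<open>\<triangleleft>\<close> 70)
    and dm :: "'g \<Rightarrow> 'g \<Rightarrow> 'g"  (infixl \<open>\<diamondop>\<close> 70)
    and star :: "'g \<Rightarrow> 'g \<Rightarrow> 'g"  (infixl \<open>\<star>\<close> 70)
  defines star_def: "x \<star> y \<equiv> x \<triangleright> y + x \<triangleleft> y + x \<diamondop> y"
  assumes bilinear_rt: "bilinear_op scale (\<triangleright>)"
    and bilinear_lt: "bilinear_op scale (\<triangleleft>)"
    and bilinear_dm: "bilinear_op scale (\<diamondop>)"
    and A1: "x \<triangleright> (y \<star> z) = (x \<triangleright> y) \<triangleright> z + y \<triangleleft> (x \<triangleright> z)"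
    and A2: "x \<triangleleft> (y \<triangleright> z) = (x \<triangleleft> y) \<triangleright> z + y \<triangleright> (x \<star> z)"
    and A3: "x \<triangleleft> (y \<triangleleft> z) = (x \<star> y) \<triangleleft> z + y \<triangleleft> (x \<triangleleft> z)"
    and A4: "x \<triangleleft> (y \<diamondop> z) + x \<diamondop> (y \<star> z) =
             (x \<diamondop> y) \<triangleright> z + (x \<star> y) \<diamondop> z + y \<triangleleft> (x \<diamondop> z) + y \<diamondop> (x \<star> z)"

end

theory Submission
  imports Defs
begin

text \<open>The Nijenhuis identity says \<open>[N x, N y] = N (x * y)\<close> for the sum \<open>*\<close> of the three
  operations. Given this, A1, A2 and A3 are the Leibniz identity with \<open>N\<close> applied to two of the
  three arguments, and A4 is \<open>- N\<close> applied to the sum of the instances with \<open>N\<close> applied to one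
  argument, minus \<open>N\<close> of the plain instance, the terms involving \<open>N [x, y]\<close> inside a bracket
  cancelling.\<close>

lemma bilinear_op_uminus_linear_comp:
  assumes "bilinear_op scale m" and "Vector_Spaces.linear scale scale N"
  shows "bilinear_op scale (\<lambda>x y. - N (m x y))"
proof -
  \<comment> \<open>One-variable form that serves both arguments of \<open>m\<close>, each with the
    other held fixed.\<close>
  have neg: "Vector_Spaces.linear scale scale (\<lambda>x. - N (f x))"
    if "Vector_Spaces.linear scale scale f" for f
    using Vector_Spaces.linear_compose[OF that assms(2)]
      vector_space_pair.linear_compose_neg[of scale scale "N \<circ> f"]
    by (simp add: o_def vector_space_pair_def Vector_Spaces.linear_def)
  then show ?thesis
    using assms(1) by (simp add: bilinear_op_def)
qed

lemma bilinear_op_linear_right: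
  assumes "bilinear_op scale m" and "Vector_Spaces.linear scale scale N"
  shows "bilinear_op scale (\<lambda>x y. m x (N y))"
  using assms Vector_Spaces.linear_compose[OF assms(2)]
  by (fastforce simp: bilinear_op_def o_def)

lemma bilinear_op_linear_left:
  assumes "bilinear_op scale m" and "Vector_Spaces.linear scale scale N"
  shows "bilinear_op scale (\<lambda>x y. m (N x) y)"
  using assms Vector_Spaces.linear_compose[OF assms(2)]
  by (fastforce simp: bilinear_op_def o_def)

theorem proposition5p3:
  fixes scale :: "complex \<Rightarrow> 'g::ab_group_add \<Rightarrow> 'g"
    and br :: "'g \<Rightarrow> 'g \<Rightarrow> 'g"
    and N :: "'g \<Rightarrow> 'g"
  assumes "leibniz_algebra scale br"
    and "nijenhuis_operator scale br N"
  shows "ns_leibniz_algebra scale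
           (\<lambda>x y. br x (N y)) (\<lambda>x y. br (N x) y) (\<lambda>x y. - N (br x y))"
proof -
  interpret leibniz_algebra scale br by (fact assms(1))
  have linN: "Vector_Spaces.linear scale scale N"
    and nij: "br (N x) (N y) = N (br (N x) y + br x (N y) - N (br x y))" for x y
    using assms(2) by (auto simp: nijenhuis_operator_def)
  interpret linN: Vector_Spaces.linear scale scale N by (fact linN)
  have linR: "Vector_Spaces.linear scale scale (\<lambda>y. br x y)"
    and linL: "Vector_Spaces.linear scale scale (\<lambda>x. br x y)" for x y
    using bilinear_br by (auto simp: bilinear_op_def)
  interpret linR: Vector_Spaces.linear scale scale "\<lambda>y. br x y" for x by (fact linR)
  interpret linL: Vector_Spaces.linear scale scale "\<lambda>x. br x y" for y by (fact linL)
  have nij_star: "N (br x (N y) + br (N x) y + - N (br x y)) = br (N x) (N y)" for x y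
    by (simp add: nij add.commute)
  show ?thesis
  proof (unfold_locales, goal_cases)
    case 1
    show ?case using bilinear_br linN by (rule bilinear_op_linear_right)
  next
    case 2
    show ?case using bilinear_br linN by (rule bilinear_op_linear_left)
  next
    case 3
    show ?case using bilinear_br linN by (rule bilinear_op_uminus_linear_comp)
  next
    case (4 x y z)
    \<comment> \<open>Leibniz at (x, N y, N z); the next two cases use (N x, y, N z) and (N x, N y,
      z).\<close>
    show ?case unfolding nij_star by (rule leibniz)
  next
    case (5 x y z)
    show ?case unfolding nij_star by (rule leibniz)
  next
    case (6 x y z)
    show ?case unfolding nij_star by (rule leibniz)
  next
    case (7 x y z)
    \<comment> \<open>A4 with all signs reversed: by \<open>nij\<close> every summand is then a
      value of \<open>N\<close>, so each side collects into a single \<open>N\<close> and it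
      suffices to compare arguments.\<close>
    have "br (N x) (N (br y z)) + N (br x (br y (N z) + br (N y) z + - N (br y z)))
        = br (N (br x y)) (N z) + N (br (br x (N y) + br (N x) y + - N (br x y)) z)
          + br (N y) (N (br x z)) + N (br y (br x (N z) + br (N x) z + - N (br x z)))"
      unfolding nij linN.add[symmetric]
      by (rule arg_cong[where f = N])
        (simp add: linL.add linL.neg linL.diff linR.add linR.neg linR.diff linN.add
          leibniz[of "N x" y z] leibniz[of x "N y" z] leibniz[of x y "N z"] leibniz[of x y z]
          algebra_simps)
    then show ?case
      by (simp add: linL.neg linR.neg algebra_simps)
  qed
qed

end
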